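(* Consider $\mathbb{R}^d$ with Lebesgue measure $\lambda^d$ and balls defined by an arbitrary norm. Let $R:=\{r_n:n\in\mathbb{Z}\}$ be a $d$-lacunary sequence of radii, i.e., $r_n>0$ and $r_{n+1}/r_n\ge d>1$ for all $n$, and let $M_R$ be the corresponding (sparsified) centered Hardy-Littlewood maximal operator. Then $$\|M_R\|_{L^1\to L^{1,\infty}}\le (e^{1/d}+1)(1+2e^{1/d}).$$ Furthermore, if the maximal function is defined using the $\ell_\infty$-norm, so balls are cubes with sides perpendicular to the coordinate axes, then $\|M_R\|_{L^1\to L^{1,\infty}}\le 6$.
   Context: Balls are $B(x,r):=\{y\in\mathbb{R}^d:\|x-y\|<r\}$ for the given norm. For a set of radii $R\subset(0,\infty)$, $M_R$ is the centered Hardy-Littlewood maximal operator with the supremum restricted to radii in $R$: $M_Rg(x):=\sup_{r\in R}\frac{1}{\lambda^d(B(x,r))}\int_{B(x,r)}|g|\,d\lambda^d$. For a sublinear operator $S$, $\|S\|_{L^1\to L^{1,\infty}}$ denotes the lowest constant $c$ such that $\lambda^d(\{Sg>a\})\le c\|g\|_{L^1(\lambda^d)}/a$ for all $g\in L^1(\lambda^d)$ and all $a>0$. *)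

theory Defs
  imports "HOL-Analysis.Analysis"
begin

definition is_norm :: "('a::real_vector \<Rightarrow> real) \<Rightarrow> bool" where
  "is_norm N \<longleftrightarrow>
     (\<forall>x. 0 \<le> N x) \<and> (\<forall>x. N x = 0 \<longleftrightarrow> x = 0) \<and>
     (\<forall>c x. N (c *\<^sub>R x) = \<bar>c\<bar> * N x) \<and>
     (\<forall>x y. N (x + y) \<le> N x + N y)"

definition norm_ball :: "('a::real_vector \<Rightarrow> real) \<Rightarrow> 'a \<Rightarrow> real \<Rightarrow> 'a set" where
  "norm_ball N x r = {y. N (x - y) < r}"

text \<open>The maximal function takes values in \<^typ>\<open>ennreal\<close>, since the supremum
  may be infinite at some points.\<close>

definition maximal_op ::
  "(real ^ 'n \<Rightarrow> real) \<Rightarrow> real set \<Rightarrow> (real ^ 'n \<Rightarrow> real) \<Rightarrow> real ^ 'n \<Rightarrow> ennreal" where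
  "maximal_op N R g x =
     (SUP r\<in>R. (\<integral>\<^sup>+y\<in>norm_ball N x r. ennreal \<bar>g y\<bar> \<partial>lebesgue)
                  / emeasure lebesgue (norm_ball N x r))"

text \<open>Measurability of the superlevel sets is demanded explicitly, because
  \<^const>\<open>emeasure\<close> is 0 on non-measurable sets. The infimum is \<open>\<infinity>\<close> if there is no
  admissible constant.\<close>

definition weak_L1_norm :: "((real ^ 'n \<Rightarrow> real) \<Rightarrow> real ^ 'n \<Rightarrow> ennreal) \<Rightarrow> ennreal" where
  "weak_L1_norm S = Inf {c. \<forall>g a. integrable lebesgue g \<longrightarrow> 0 < a \<longrightarrow>
     {x. ennreal a < S g x} \<in> sets lebesgue \<and>
     emeasure lebesgue {x. ennreal a < S g x}
       \<le> c * ennreal (\<integral>x. \<bar>g x\<bar> \<partial>lebesgue) / ennreal a}"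

definition lacunary :: "real \<Rightarrow> (int \<Rightarrow> real) \<Rightarrow> bool" where
  "lacunary q r \<longleftrightarrow> 1 < q \<and> (\<forall>n. 0 < r n) \<and> (\<forall>n. q \<le> r (n + 1) / r n)"

end

theory Submission
  imports Defs
begin

text \<open>
  For every norm on \<open>\<real>\<^sup>d\<close> and every \<open>q\<close>-lacunary sequence of radii, the weak type constant is
  at most \<open>1 + (1 + 1/q)\<^sup>d\<close>. For \<open>q = d\<close> this is at most \<open>1 + e < 4\<close>, whereas both constants in
  the theorem are at least \<open>6\<close>; cubes are the case of the supremum norm.

  The proof is a fractional covering argument in the spirit of Lindenstrauss and of Naor and Tao.
  Fix \<open>g \<ge> 0\<close> and \<open>a\<close>, list the radii below a given one in decreasing order as \<open>s\<^sub>0 > s\<^sub>1 > \<dots>\<close>,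
  and let \<open>E\<^sub>i\<close> be the set of points at which the average of \<open>g\<close> over the ball of radius \<open>s\<^sub>i\<close>
  exceeds \<open>a\<close>. Instead of selecting balls, give the ball of radius \<open>s\<^sub>i\<close> about \<open>x \<in> E\<^sub>i\<close> a weight
  \<open>w\<^sub>i(x) \<in> [0,1]\<close>, with \<open>w\<^sub>i = 0\<close> off \<open>E\<^sub>i\<close>, in such a way that
    \<^item> the total overlap \<open>\<Sum>\<^sub>i |B(y,s\<^sub>i)|\<^sup>-\<^sup>1 \<integral>\<^bsub>B(y,s\<^sub>i)\<^esub> w\<^sub>i\<close> is at most 1 at every point \<open>y\<close>, and
    \<^item> the weights retain a fixed share of the measure:
      \<open>|\<Union>\<^sub>i E\<^sub>i| \<le> (1 + (1 + 1/q)\<^sup>d) \<Sum>\<^sub>i \<integral> w\<^sub>i\<close>.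

  Integrating \<open>a w\<^sub>i \<le> w\<^sub>i \<cdot> (average of g)\<close> and exchanging the order of integration turns the first
  property into \<open>a \<Sum>\<^sub>i \<integral> w\<^sub>i \<le> \<integral> g\<close> (\<open>weight_sum_le\<close>); combined with the second one
  (\<open>emeasure_levels_le\<close>) this is the weak type bound.

  The weights are chosen greedily from the largest radius downwards. The ball about \<open>x\<close> receives
  whatever remains of a capacity of 1 after subtracting the load that larger balls put on it, where a
  larger ball counts fully as soon as it meets the ball of radius \<open>s\<^sub>i\<close> about \<open>x\<close>. So the overlap never
  exceeds 1 (\<open>partial_overlap_le_1\<close>). What is lost at \<open>x\<close> is at most the load at \<open>x\<close>, and two
  balls of radii \<open>s\<^sub>j\<close> and \<open>s\<^sub>i \<le> s\<^sub>j/q\<close> meet only if their centres are within \<open>(1 + 1/q) s\<^sub>j\<close>.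
  Hence the load of the balls of radius \<open>s\<^sub>j\<close> has integral at most \<open>(1 + 1/q)\<^sup>d \<integral> w\<^sub>j\<close>, uniformly
  in \<open>i\<close>. This is where lacunarity enters.
\<close>

section \<open>Balls of an arbitrary norm\<close>

locale arbitrary_norm =
  fixes N :: "'a::euclidean_space \<Rightarrow> real"
  assumes is_norm: "is_norm N"
begin

lemma nonneg: "0 \<le> N x"
  and zero_iff: "N x = 0 \<longleftrightarrow> x = 0"
  and scale: "N (c *\<^sub>R x) = \<bar>c\<bar> * N x"
  and triangle: "N (x + y) \<le> N x + N y"
  using is_norm by (auto simp: is_norm_def)

lemma zero: "N 0 = 0"
  by (simp add: zero_iff)

lemma minus: "N (- x) = N x"
  using scale[of "-1" x] by simp

lemma commute: "N (x - y) = N (y - x)"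
  using minus[of "x - y"] by simp

lemma le_multiple_of_norm: "N x \<le> (\<Sum>b\<in>Basis. N b) * norm x"
proof -
  have sub: "N (\<Sum>b\<in>A. f b) \<le> (\<Sum>b\<in>A. N (f b))" if "finite A" for A :: "'a set" and f
    using that by (induction) (auto simp: zero intro: order.trans[OF triangle])
  have "N x = N (\<Sum>b\<in>Basis. (x \<bullet> b) *\<^sub>R b)"
    by (simp add: euclidean_representation)
  also have "\<dots> \<le> (\<Sum>b\<in>Basis. \<bar>x \<bullet> b\<bar> * N b)"
    using sub[of Basis "\<lambda>b. (x \<bullet> b) *\<^sub>R b"] by (simp add: scale)
  also have "\<dots> \<le> (\<Sum>b\<in>Basis. norm x * N b)"
    by (intro sum_mono mult_right_mono nonneg Basis_le_norm)
  finally show ?thesis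
    by (simp add: sum_distrib_left mult.commute)
qed

lemma continuous: "continuous_on A N"
proof -
  let ?C = "\<Sum>b\<in>Basis. N b"
  have *: "\<bar>N x - N y\<bar> \<le> ?C * dist x y" for x y
    using triangle[of "x - y" y] triangle[of "y - x" x] commute[of x y]
      le_multiple_of_norm[of "x - y"]
    by (simp add: dist_norm)
  have "?C-lipschitz_on A N"
    by (rule lipschitz_onI) (auto simp: dist_real_def * intro: sum_nonneg nonneg)
  then show ?thesis
    by (rule lipschitz_on_continuous_on)
qed

text \<open>By compactness of the Euclidean unit sphere. Together with the previous bound this is the
  equivalence of norms, which makes balls open and bounded.\<close>

lemma ex_lower_bound: "\<exists>c>0. \<forall>x. c * norm x \<le> N x"
proof -
  have "sphere (0::'a) 1 \<noteq> {}"
    by simp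
  then obtain z where z: "z \<in> sphere 0 1" "\<And>y. y \<in> sphere 0 1 \<Longrightarrow> N z \<le> N y"
    using continuous_attains_inf[OF compact_sphere _ continuous] by metis
  have "0 < N z"
    using z(1) nonneg[of z] zero_iff[of z] by (auto simp: less_le)
  moreover have "N z * norm x \<le> N x" for x
  proof (cases "x = 0")
    case False
    then have "N z \<le> N ((1 / norm x) *\<^sub>R x)"
      by (intro z(2)) simp
    then show ?thesis
      using False by (simp add: scale field_simps)
  qed (simp add: nonneg)
  ultimately show ?thesis by blast
qed

lemma ball_open: "open (norm_ball N x r)"
  unfolding norm_ball_def
  by (intro open_Collect_less continuous_on_compose2[OF continuous[of UNIV]] continuous_intros) auto

lemma ball_sets [measurable]: "norm_ball N x r \<in> sets borel"
  by (simp add: ball_open borel_open)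

lemma ball_bounded: "bounded (norm_ball N x r)"
proof -
  obtain c where c: "0 < c" "\<And>x. c * norm x \<le> N x"
    using ex_lower_bound by auto
  show ?thesis
    unfolding bounded_def
  proof (intro exI ballI)
    fix y assume "y \<in> norm_ball N x r"
    then have "c * norm (x - y) \<le> r"
      using c(2)[of "x - y"] by (simp add: norm_ball_def)
    then show "dist x y \<le> r / c"
      using c(1) by (simp add: dist_norm field_simps)
  qed
qed

lemma mem_ball_commute: "y \<in> norm_ball N x r \<longleftrightarrow> x \<in> norm_ball N y r"
  by (simp add: norm_ball_def commute)

text \<open>Only the radius matters, by translation invariance (\<open>emeasure_ball\<close>), so every average over a
  ball of radius \<open>r\<close> is normalized by the same number.\<close>

definition volume :: "real \<Rightarrow> ennreal" where
  "volume r = emeasure lborel (norm_ball N 0 r)"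

lemma emeasure_ball: "emeasure lborel (norm_ball N x r) = volume r"
proof -
  have "norm_ball N x r = (+) x ` norm_ball N 0 r"
    unfolding norm_ball_def
    by (auto simp: minus intro!: image_eqI[of _ _ "_ - x"]) (metis commute)
  then have "emeasure lebesgue (norm_ball N x r) = emeasure lebesgue (norm_ball N 0 r)"
    using emeasure_lebesgue_affine[of 1 x "norm_ball N 0 r"] by (simp add: add.commute)
  then show ?thesis
    by (simp add: volume_def)
qed

lemma volume_finite: "volume r < \<infinity>"
  unfolding volume_def using emeasure_bounded_finite[OF ball_bounded] by simp

lemma volume_pos: "0 < r \<Longrightarrow> 0 < volume r"
proof -
  assume "0 < r"
  then have "(0::'a) \<in> norm_ball N 0 r"
    by (simp add: norm_ball_def zero)
  then have "\<not> negligible (norm_ball N 0 r)"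
    using open_not_negligible[OF ball_open] by blast
  then show ?thesis
    by (auto simp: volume_def negligible_iff_emeasure0 zero_less_iff_neq_zero)
qed

lemma volume_scale: "0 < c \<Longrightarrow> volume (c * r) = ennreal (c ^ DIM('a)) * volume r"
proof -
  assume c: "0 < c"
  have image: "norm_ball N 0 (c * r) = (*\<^sub>R) c ` norm_ball N 0 r"
  proof (intro equalityI subsetI)
    fix y assume "y \<in> norm_ball N 0 (c * r)"
    then have "(1 / c) *\<^sub>R y \<in> norm_ball N 0 r" "y = c *\<^sub>R ((1 / c) *\<^sub>R y)"
      using c by (auto simp: norm_ball_def minus scale field_simps)
    then show "y \<in> (*\<^sub>R) c ` norm_ball N 0 r" by blast
  qed (use c in \<open>auto simp: norm_ball_def minus scale\<close>)
  then show ?thesis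
    using emeasure_lebesgue_affine[of c 0 "norm_ball N 0 r"] c
    by (simp add: volume_def flip: image)
qed

section \<open>Masses of balls\<close>

definition mass :: "('a \<Rightarrow> ennreal) \<Rightarrow> real \<Rightarrow> 'a \<Rightarrow> ennreal" where
  "mass u r x = (\<integral>\<^sup>+y. u y * indicator (norm_ball N x r) y \<partial>lborel)"

lemma ball_indicator_measurable [measurable]:
  "(\<lambda>p. indicator (norm_ball N (fst p) r) (snd p) :: ennreal) \<in> borel_measurable (borel \<Otimes>\<^sub>M borel)"
proof -
  have "open {p :: 'a \<times> 'a. N (fst p - snd p) < r}"
    by (intro open_Collect_less continuous_on_compose2[OF continuous[of UNIV]] continuous_intros) auto
  then have [measurable]: "{p :: 'a \<times> 'a. N (fst p - snd p) < r} \<in> sets (borel \<Otimes>\<^sub>M borel)"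
    unfolding borel_prod by (rule borel_open)
  have "(\<lambda>p. indicator (norm_ball N (fst p) r) (snd p) :: ennreal)
      = indicator {p :: 'a \<times> 'a. N (fst p - snd p) < r}"
    by (auto simp: norm_ball_def indicator_def)
  then show ?thesis by simp
qed

lemma mass_measurable [measurable]:
  assumes [measurable]: "u \<in> borel_measurable borel"
  shows "mass u r \<in> borel_measurable borel"
proof -
  have [measurable]: "(\<lambda>p. u (snd p) * indicator (norm_ball N (fst p) r) (snd p))
      \<in> borel_measurable (borel \<Otimes>\<^sub>M lborel)"
    using ball_indicator_measurable by measurable
  show ?thesis
    unfolding mass_def
    by (intro lborel.borel_measurable_nn_integral) (simp add: case_prod_beta')
qed

text \<open>The kernel \<open>1\<^bsub>N(x - y) < r\<^esub>\<close> is symmetric, so the operator \<open>u \<mapsto> mass u r\<close> is self-adjoint by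
  Tonelli's theorem. This moves the averages from the function to the weights.\<close>

lemma mass_swap:
  assumes [measurable]: "u \<in> borel_measurable borel" "v \<in> borel_measurable borel"
  shows "(\<integral>\<^sup>+x. u x * mass v r x \<partial>lborel) = (\<integral>\<^sup>+y. v y * mass u r y \<partial>lborel)"
proof -
  have [measurable]: "(\<lambda>p. u (fst p) * (v (snd p) * indicator (norm_ball N (fst p) r) (snd p)))
      \<in> borel_measurable (lborel \<Otimes>\<^sub>M lborel)"
    using ball_indicator_measurable by measurable
  have "(\<integral>\<^sup>+x. u x * mass v r x \<partial>lborel)
      = (\<integral>\<^sup>+x. \<integral>\<^sup>+y. u x * (v y * indicator (norm_ball N x r) y) \<partial>lborel \<partial>lborel)"
    by (simp add: mass_def nn_integral_cmult)
  also have "\<dots> = (\<integral>\<^sup>+y. \<integral>\<^sup>+x. u x * (v y * indicator (norm_ball N x r) y) \<partial>lborel \<partial>lborel)"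
    by (rule lborel_pair.Fubini'[symmetric]) (simp add: case_prod_beta')
  also have "\<dots> = (\<integral>\<^sup>+y. \<integral>\<^sup>+x. v y * (u x * indicator (norm_ball N y r) x) \<partial>lborel \<partial>lborel)"
    by (intro nn_integral_cong) (auto simp: indicator_def mem_ball_commute mult.commute)
  also have "\<dots> = (\<integral>\<^sup>+y. v y * mass u r y \<partial>lborel)"
    by (simp add: mass_def nn_integral_cmult)
  finally show ?thesis .
qed

lemma nn_integral_mass:
  assumes [measurable]: "u \<in> borel_measurable borel"
  shows "(\<integral>\<^sup>+x. mass u r x \<partial>lborel) = volume r * (\<integral>\<^sup>+y. u y \<partial>lborel)"
proof -
  have "mass (\<lambda>_. 1) r y = volume r" for y
    by (simp add: mass_def emeasure_ball)
  then show ?thesis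
    using mass_swap[of "\<lambda>_. 1" u r] by (simp add: nn_integral_multc mult.commute)
qed

lemma mass_mono:
  "(\<And>y. y \<in> norm_ball N x r \<Longrightarrow> u y \<le> v y \<and> y \<in> norm_ball N x' r') \<Longrightarrow> mass u r x \<le> mass v r' x'"
  unfolding mass_def by (intro nn_integral_mono) (auto simp: indicator_def)

end

section \<open>Greedy weights for a decreasing sequence of radii\<close>

locale lacunary_levels = arbitrary_norm N for N :: "'a::euclidean_space \<Rightarrow> real" +
  fixes q :: real and s :: "nat \<Rightarrow> real" and E :: "nat \<Rightarrow> 'a set"
  assumes q: "1 < q"
    and s_pos: "0 < s i"
    and s_step: "q * s (Suc i) \<le> s i"
    and E_sets [measurable]: "E i \<in> sets borel"
begin

text \<open>The subtraction on \<^typ>\<open>ennreal\<close> is truncated at 0, so a weight vanishes where the larger balls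
  have used up the whole capacity. The radius \<open>s j + s i\<close> captures exactly the centres of balls of
  radius \<open>s j\<close> that meet the ball of radius \<open>s i\<close> about \<open>x\<close>, while the normalization is still by
  the volume of a ball of radius \<open>s j\<close>.\<close>

fun weight :: "nat \<Rightarrow> 'a \<Rightarrow> ennreal" where
  "weight i x =
     indicator (E i) x * (1 - (\<Sum>j<i. mass (\<lambda>y. weight j y) (s j + s i) x / volume (s j)))"

declare weight.simps [simp del]

definition load :: "nat \<Rightarrow> 'a \<Rightarrow> ennreal" where
  "load i x = (\<Sum>j<i. mass (weight j) (s j + s i) x / volume (s j))"

definition overlap :: "nat \<Rightarrow> 'a \<Rightarrow> ennreal" where
  "overlap i y = mass (weight i) (s i) y / volume (s i)"

lemma weight_eq: "weight i x = indicator (E i) x * (1 - load i x)"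
  by (simp add: weight.simps[of i] load_def)

lemma weight_measurable [measurable]: "weight i \<in> borel_measurable borel"
proof (induction i rule: less_induct)
  case (less i)
  have [measurable]: "(\<lambda>x. mass (weight j) (s j + s i) x / volume (s j)) \<in> borel_measurable borel"
    if "j < i" for j
    using less[OF that] by measurable
  have [measurable]: "load i \<in> borel_measurable borel"
    unfolding load_def by (intro borel_measurable_sum) simp
  show ?case
    unfolding weight_eq by measurable
qed

lemma overlap_measurable [measurable]: "overlap i \<in> borel_measurable borel"
  unfolding overlap_def by measurable

lemma s_separated: "j < i \<Longrightarrow> q * s i \<le> s j"
proof (induction i)
  case (Suc i)
  show ?case
  proof (cases "j = i")
    case False
    have "s (Suc i) \<le> q * s (Suc i)"
      using q s_pos[of "Suc i"] by simp
    also have "\<dots> \<le> s i"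
      by (rule s_step)
    finally have "q * s (Suc i) \<le> q * s i"
      using q by simp
    also have "\<dots> \<le> s j"
      using Suc False by simp
    finally show ?thesis .
  qed (simp add: s_step)
qed simp

text \<open>Let \<open>S\<close> be the overlap at \<open>y\<close> of the first \<open>n\<close> families. Every ball of the next family that
  contains \<open>y\<close> carries a load of at least \<open>S\<close>, because a larger ball containing \<open>y\<close> meets it at
  \<open>y\<close>. Its weight is therefore at most \<open>1 - S\<close>, and so is the average of these weights, which is
  what the next family adds at \<open>y\<close>.\<close>

lemma partial_overlap_le_1: "(\<Sum>i<n. overlap i y) \<le> 1"
proof (induction n)
  case (Suc n)
  let ?S = "\<Sum>i<n. overlap i y"
  have load: "?S \<le> load n x" if "x \<in> norm_ball N y (s n)" for x
    unfolding load_def overlap_def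
  proof (intro sum_mono divide_right_mono_ennreal mass_mono conjI order_refl)
    fix j z assume "z \<in> norm_ball N y (s j)"
    then show "z \<in> norm_ball N x (s j + s n)"
      using that triangle[of "x - y" "y - z"] commute[of x y] by (simp add: norm_ball_def)
  qed
  have "mass (weight n) (s n) y \<le> mass (\<lambda>_. 1 - ?S) (s n) y"
    using load by (intro mass_mono)
      (auto simp: weight_eq indicator_def intro!: ennreal_minus_mono)
  also have "\<dots> = (1 - ?S) * volume (s n)"
    by (simp add: mass_def nn_integral_cmult emeasure_ball)
  finally have "overlap n y \<le> (1 - ?S) * volume (s n) / volume (s n)"
    unfolding overlap_def by (rule divide_right_mono_ennreal)
  also have "\<dots> = 1 - ?S"
    using volume_pos[OF s_pos[of n]] volume_finite[of "s n"]
    by (intro ennreal_mult_divide_eq) auto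
  finally have "?S + overlap n y \<le> ?S + (1 - ?S)"
    by (rule add_left_mono)
  \<comment> \<open>The truncated subtraction cancels because \<open>?S \<le> 1\<close> by the induction hypothesis.\<close>
  also have "\<dots> = 1"
    using Suc by (simp add: add_diff_inverse_ennreal)
  finally show ?case by simp
qed simp

lemma overlap_le_1: "(\<Sum>i. overlap i y) \<le> 1"
  by (intro suminf_le_const summableI partial_overlap_le_1)

definition expansion :: real where
  "expansion = (1 + 1 / q) ^ DIM('a)"

text \<open>The enlarged radius no longer depends on the level \<open>i\<close>. A single function thus dominates the
  loads at all levels, and the loss is paid for only once.\<close>

lemma load_le:
  "load i x \<le> (\<Sum>j. mass (weight j) ((1 + 1 / q) * s j) x / volume (s j))"
proof -
  have "load i x \<le> (\<Sum>j<i. mass (weight j) ((1 + 1 / q) * s j) x / volume (s j))"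
    unfolding load_def
  proof (intro sum_mono divide_right_mono_ennreal mass_mono conjI order_refl)
    fix j z assume "j \<in> {..<i}" and z: "z \<in> norm_ball N x (s j + s i)"
    then have "s i \<le> s j / q"
      using s_separated[of j i] q by (simp add: field_simps)
    then show "z \<in> norm_ball N x ((1 + 1 / q) * s j)"
      using z by (simp add: norm_ball_def algebra_simps)
  qed
  also have "\<dots> \<le> (\<Sum>j. mass (weight j) ((1 + 1 / q) * s j) x / volume (s j))"
    by (intro sum_le_suminf summableI) auto
  finally show ?thesis .
qed

text \<open>A point \<open>x\<close> of \<open>E i\<close> satisfies \<open>1 \<le> weight i x + load i x\<close>. Replacing the two terms by bounds
  independent of \<open>i\<close> and integrating, the first gives the sum of the integrals of the weights and the
  second the same sum times the volume ratio of concentric balls with radii in proportion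
  \<open>1 + 1/q\<close>.\<close>

lemma emeasure_levels_le:
  "emeasure lborel (\<Union>i. E i) \<le> ennreal (1 + expansion) * (\<Sum>i. \<integral>\<^sup>+x. weight i x \<partial>lborel)"
proof -
  let ?L = "\<lambda>x. \<Sum>j. mass (weight j) ((1 + 1 / q) * s j) x / volume (s j)"
  let ?W = "\<Sum>i. \<integral>\<^sup>+x. weight i x \<partial>lborel"
  have vol: "volume (s j) \<noteq> 0" "volume (s j) \<noteq> \<infinity>" for j
    using volume_pos[OF s_pos[of j]] volume_finite[of "s j"] by auto
  have "indicator (\<Union>i. E i) x \<le> (\<Sum>i. weight i x) + ?L x" for x
  proof (cases "x \<in> (\<Union>i. E i)")
    case True
    then obtain i where "x \<in> E i" by auto
    \<comment> \<open>If \<open>load i x > 1\<close>, the weight is 0 and the load alone suffices.\<close>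
    then have "(1::ennreal) \<le> load i x + weight i x"
      by (simp add: weight_eq) (metis add_diff_inverse_ennreal diff_eq_0_iff_ennreal add.right_neutral
          linear ennreal_one_less_top)
    also have "\<dots> \<le> ?L x + (\<Sum>i. weight i x)"
      using sum_le_suminf[of "\<lambda>i. weight i x" "{i}"] by (intro add_mono load_le) auto
    finally show ?thesis
      using True by (simp add: add.commute)
  qed simp
  moreover have "emeasure lborel (\<Union>i. E i) = (\<integral>\<^sup>+x. indicator (\<Union>i. E i) x \<partial>lborel)"
    by simp
  ultimately have "emeasure lborel (\<Union>i. E i) \<le> (\<integral>\<^sup>+x. (\<Sum>i. weight i x) + ?L x \<partial>lborel)"
    by (simp only: nn_integral_mono)
  also have "\<dots> = ?W + (\<Sum>j. \<integral>\<^sup>+x. mass (weight j) ((1 + 1 / q) * s j) x / volume (s j) \<partial>lborel)"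
    by (simp add: nn_integral_add nn_integral_suminf)
  also have "(\<lambda>j. \<integral>\<^sup>+x. mass (weight j) ((1 + 1 / q) * s j) x / volume (s j) \<partial>lborel)
      = (\<lambda>j. ennreal expansion * (\<integral>\<^sup>+x. weight j x \<partial>lborel))"
  proof
    fix j
    have "(\<integral>\<^sup>+x. mass (weight j) ((1 + 1 / q) * s j) x / volume (s j) \<partial>lborel)
        = (ennreal expansion * (\<integral>\<^sup>+x. weight j x \<partial>lborel)) * volume (s j) / volume (s j)"
      using volume_scale[of "1 + 1 / q" "s j"] q
      by (simp add: nn_integral_divide nn_integral_mass expansion_def add_pos_pos mult_ac)
    then show "(\<integral>\<^sup>+x. mass (weight j) ((1 + 1 / q) * s j) x / volume (s j) \<partial>lborel)
        = ennreal expansion * (\<integral>\<^sup>+x. weight j x \<partial>lborel)"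
      using vol by (simp add: ennreal_mult_divide_eq)
  qed
  also have "?W + (\<Sum>j. ennreal expansion * (\<integral>\<^sup>+x. weight j x \<partial>lborel)) = (1 + ennreal expansion) * ?W"
    by (simp add: distrib_right)
  also have "1 + ennreal expansion = ennreal (1 + expansion)"
    using q by (simp add: expansion_def ennreal_plus)
  finally show ?thesis .
qed

text \<open>Swapping the integrals replaces the averages of \<open>g\<close> against the weights by the integral of \<open>g\<close>
  against the total overlap, which is at most 1.\<close>

lemma weight_sum_le:
  fixes g :: "'a \<Rightarrow> ennreal"
  assumes [measurable]: "g \<in> borel_measurable borel"
    and large: "\<And>i x. x \<in> E i \<Longrightarrow> a \<le> mass g (s i) x / volume (s i)"
  shows "a * (\<Sum>i. \<integral>\<^sup>+x. weight i x \<partial>lborel) \<le> (\<integral>\<^sup>+x. g x \<partial>lborel)"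
proof -
  have "a * (\<Sum>i. \<integral>\<^sup>+x. weight i x \<partial>lborel) = (\<Sum>i. \<integral>\<^sup>+x. weight i x * a \<partial>lborel)"
    by (simp add: nn_integral_multc mult.commute[of a])
  also have "\<dots> \<le> (\<Sum>i. \<integral>\<^sup>+x. weight i x * (mass g (s i) x / volume (s i)) \<partial>lborel)"
    using large by (intro suminf_le summableI nn_integral_mono)
      (auto simp: weight_eq indicator_def intro!: mult_left_mono)
  also have "\<dots> = (\<Sum>i. \<integral>\<^sup>+y. g y * overlap i y \<partial>lborel)"
    using mass_swap[of "weight _" g]
    by (simp add: overlap_def ennreal_times_divide nn_integral_divide)
  also have "\<dots> = (\<integral>\<^sup>+y. g y * (\<Sum>i. overlap i y) \<partial>lborel)"
    by (subst nn_integral_suminf[symmetric]) auto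
  also have "\<dots> \<le> (\<integral>\<^sup>+y. g y * 1 \<partial>lborel)"
    by (intro nn_integral_mono mult_left_mono overlap_le_1) simp
  finally show ?thesis by simp
qed

lemma weak_type_levels:
  fixes g :: "'a \<Rightarrow> ennreal"
  assumes [measurable]: "g \<in> borel_measurable borel"
    and large: "\<And>i x. x \<in> E i \<Longrightarrow> a \<le> mass g (s i) x / volume (s i)"
  shows "a * emeasure lborel (\<Union>i. E i) \<le> ennreal (1 + expansion) * (\<integral>\<^sup>+x. g x \<partial>lborel)"
proof -
  have "a * emeasure lborel (\<Union>i. E i)
      \<le> a * (ennreal (1 + expansion) * (\<Sum>i. \<integral>\<^sup>+x. weight i x \<partial>lborel))"
    by (intro mult_left_mono emeasure_levels_le) simp
  also have "\<dots> = ennreal (1 + expansion) * (a * (\<Sum>i. \<integral>\<^sup>+x. weight i x \<partial>lborel))"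
    by (simp add: mult_ac)
  also have "\<dots> \<le> ennreal (1 + expansion) * (\<integral>\<^sup>+x. g x \<partial>lborel)"
    by (intro mult_left_mono weight_sum_le assms) simp_all
  finally show ?thesis .
qed

end

section \<open>The weak type bound\<close>

text \<open>A sequence indexed by the integers has no largest radius to start from. The radii
  \<open>r m, r (m - 1), \<dots>\<close> do, and their bound does not depend on \<open>m\<close>, so continuity of the measure from
  below gives all radii.\<close>

lemma (in arbitrary_norm) weak_type_borel:
  fixes g :: "'a \<Rightarrow> ennreal" and r :: "int \<Rightarrow> real"
  assumes r: "lacunary q r" and [measurable]: "g \<in> borel_measurable borel"
  shows "a * emeasure lborel (\<Union>n. {x. a < mass g (r n) x / volume (r n)})
           \<le> ennreal (1 + (1 + 1 / q) ^ DIM('a)) * (\<integral>\<^sup>+x. g x \<partial>lborel)"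
proof -
  define F where "F n = {x. a < mass g (r n) x / volume (r n)}" for n
  have [measurable]: "F n \<in> sets borel" for n
    unfolding F_def by measurable
  define U where "U m = (\<Union>i::nat. F (int m - int i))" for m :: nat
  have [measurable]: "U m \<in> sets borel" for m
    unfolding U_def by measurable
  have U_bound: "a * emeasure lborel (U m)
      \<le> ennreal (1 + (1 + 1 / q) ^ DIM('a)) * (\<integral>\<^sup>+x. g x \<partial>lborel)" for m
  proof -
    have r': "1 < q" "0 < r n" "q * r (n - 1) \<le> r n" for n
      using r spec[of "\<lambda>n. q \<le> r (n + 1) / r n" "n - 1"] unfolding lacunary_def
      by (auto simp: field_simps)
    have step: "q * r (int m - int (Suc i)) \<le> r (int m - int i)" for i
      using r'(3)[of "int m - int i"] by (simp add: algebra_simps)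
    interpret lacunary_levels N q "\<lambda>i. r (int m - int i)" "\<lambda>i. F (int m - int i)"
      by unfold_locales (use r' step in auto)
    show ?thesis
      using weak_type_levels[of g a] unfolding expansion_def U_def by (auto simp: F_def)
  qed
  have "incseq U"
    unfolding U_def
  proof (rule incseq_SucI)
    fix m
    have "F (int m - int i) = F (int (Suc m) - int (Suc i))" for i by simp
    then show "(\<Union>i. F (int m - int i)) \<subseteq> (\<Union>i. F (int (Suc m) - int i))" by blast
  qed
  have "x \<in> U (nat n)" if "x \<in> F n" for x n
  proof -
    have "n = int (nat n) - int (nat (- n))" by simp
    then show ?thesis using that unfolding U_def by (metis UNIV_I UN_I)
  qed
  then have "(\<Union>n. F n) \<subseteq> (\<Union>m. U m)"
    by blast
  moreover have "(\<Union>m. U m) \<subseteq> (\<Union>n. F n)"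
    unfolding U_def by blast
  ultimately have "(\<Union>n. F n) = (\<Union>m. U m)"
    by (rule equalityI)
  also have "emeasure lborel (\<Union>m. U m) = (SUP m. emeasure lborel (U m))"
    using \<open>incseq U\<close> by (intro SUP_emeasure_incseq[symmetric]) auto
  finally have "a * emeasure lborel (\<Union>n. F n) = (SUP m. a * emeasure lborel (U m))"
    by (simp add: SUP_mult_left_ennreal)
  also have "\<dots> \<le> ennreal (1 + (1 + 1 / q) ^ DIM('a)) * (\<integral>\<^sup>+x. g x \<partial>lborel)"
    by (intro SUP_least U_bound)
  finally show ?thesis
    unfolding F_def .
qed

text \<open>The passage from Borel to Lebesgue measurable functions: \<open>\<bar>g\<bar>\<close> is almost everywhere equal to a
  Borel function, and this changes none of the averages.\<close>

lemma weak_L1_norm_lacunary: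
  fixes N :: "real ^ 'n \<Rightarrow> real" and r :: "int \<Rightarrow> real"
  assumes "is_norm N" and r: "lacunary q r"
  shows "weak_L1_norm (maximal_op N (range r)) \<le> ennreal (1 + (1 + 1 / q) ^ CARD('n))"
  unfolding weak_L1_norm_def
proof (rule Inf_lower, safe)
  interpret arbitrary_norm N by unfold_locales fact
  fix g :: "real ^ 'n \<Rightarrow> real" and a :: real
  assume g: "integrable lebesgue g" and a: "0 < a"
  obtain h where [measurable]: "h \<in> borel_measurable lborel"
    and "AE x in lborel. ennreal \<bar>g x\<bar> = h x"
    using completion_ex_borel_measurable[of "\<lambda>x. ennreal \<bar>g x\<bar>" lborel]
      borel_measurable_integrable[OF g] by auto
  then have h: "AE x in lebesgue. ennreal \<bar>g x\<bar> = h x"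
    by (intro AE_completion)
  let ?F = "\<Union>n. {x. ennreal a < mass h (r n) x / volume (r n)}"
  have "maximal_op N (range r) g x = (SUP n. mass h (r n) x / volume (r n))" for x
  proof -
    have "(\<integral>\<^sup>+y\<in>norm_ball N x t. ennreal \<bar>g y\<bar> \<partial>lebesgue)
        / emeasure lebesgue (norm_ball N x t) = mass h t x / volume t" for t
    proof -
      have "(\<integral>\<^sup>+y\<in>norm_ball N x t. ennreal \<bar>g y\<bar> \<partial>lebesgue)
          = (\<integral>\<^sup>+y\<in>norm_ball N x t. h y \<partial>lebesgue)"
        using h by (intro nn_integral_cong_AE) (auto elim!: eventually_mono)
      then show ?thesis
        by (simp add: mass_def nn_integral_completion emeasure_ball)
    qed
    then show ?thesis
      by (simp add: maximal_op_def image_comp)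
  qed
  then have level: "{x. ennreal a < maximal_op N (range r) g x} = ?F"
    by (auto simp: less_SUP_iff)
  have F: "?F \<in> sets borel"
    by measurable
  then show "{x. ennreal a < maximal_op N (range r) g x} \<in> sets lebesgue"
    unfolding level by simp
  have "ennreal a * emeasure lborel ?F
      \<le> ennreal (1 + (1 + 1 / q) ^ CARD('n)) * (\<integral>\<^sup>+x. h x \<partial>lborel)"
    using weak_type_borel[OF r, of h "ennreal a"] by simp
  also have "(\<integral>\<^sup>+x. h x \<partial>lborel) = (\<integral>\<^sup>+x. ennreal \<bar>g x\<bar> \<partial>lebesgue)"
    unfolding nn_integral_completion[symmetric, of lborel h]
    using h by (intro nn_integral_cong_AE) (auto elim!: eventually_mono)
  also have "\<dots> = ennreal (\<integral>x. \<bar>g x\<bar> \<partial>lebesgue)"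
    using g by (intro nn_integral_eq_integral) auto
  finally have "emeasure lborel ?F * ennreal a / ennreal a
      \<le> ennreal (1 + (1 + 1 / q) ^ CARD('n)) * ennreal (\<integral>x. \<bar>g x\<bar> \<partial>lebesgue) / ennreal a"
    by (intro divide_right_mono_ennreal) (simp add: mult.commute)
  then show "emeasure lebesgue {x. ennreal a < maximal_op N (range r) g x}
      \<le> ennreal (1 + (1 + 1 / q) ^ CARD('n)) * ennreal (\<integral>x. \<bar>g x\<bar> \<partial>lebesgue) / ennreal a"
    unfolding level using a F by (simp add: ennreal_mult_divide_eq)
qed

lemma is_norm_infnorm: "is_norm (infnorm :: 'a::euclidean_space \<Rightarrow> real)"
  by (simp add: is_norm_def infnorm_pos_le infnorm_eq_0 infnorm_mul infnorm_triangle)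

theorem theorem5p1:
  fixes r :: "int \<Rightarrow> real"
  assumes "lacunary (real CARD('n::finite)) r"
  shows "(\<forall>N :: real ^ 'n \<Rightarrow> real. is_norm N \<longrightarrow>
            weak_L1_norm (maximal_op N (range r))
              \<le> ennreal ((exp (1 / real CARD('n)) + 1) * (1 + 2 * exp (1 / real CARD('n)))))
       \<and> weak_L1_norm (maximal_op (infnorm :: real ^ 'n \<Rightarrow> real) (range r)) \<le> 6"
proof -
  let ?d = "CARD('n)"
  \<comment> \<open>\<open>(1 + 1/d)\<^sup>d \<le> e \<le> 3\<close>, so the constant of the preceding lemma is at most 4.\<close>
  have "(1 + 1 / real ?d) ^ ?d \<le> exp (1 / real ?d) ^ ?d"
    by (intro power_mono) auto
  also have "\<dots> \<le> 3"
    using exp_le by (simp flip: exp_of_nat_mult)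
  finally have "ennreal (1 + (1 + 1 / real ?d) ^ ?d) \<le> ennreal 4"
    by (intro ennreal_leI) simp
  then have four: "weak_L1_norm (maximal_op N (range r)) \<le> ennreal 4"
    if "is_norm N" for N :: "real ^ 'n \<Rightarrow> real"
    using weak_L1_norm_lacunary[OF that assms] by (rule order.trans[rotated])
  \<comment> \<open>\<open>exp (1/d) \<ge> 1\<close> makes the first of the two target constants at least 6.\<close>
  have "2 * 3 \<le> (exp (1 / real ?d) + 1) * (1 + 2 * exp (1 / real ?d))"
    by (intro mult_mono) auto
  then have "ennreal 4 \<le> ennreal ((exp (1 / real ?d) + 1) * (1 + 2 * exp (1 / real ?d)))"
    by (intro ennreal_leI) simp
  moreover have "ennreal 4 \<le> 6"
    by simp
  ultimately show ?thesis
    using four is_norm_infnorm order.trans by blast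
qed

end
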